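(* The set $S_0^{3,tr}$ includes a primitive element (over $\mathbb{Q}$) of any totally real cubic field. The same is true of $S_{-3}^{3,tr}$.
   Context: A totally real cubic field is a subfield of $\mathbb{R}$ of degree three over $\mathbb{Q}$ all of whose embeddings into $\mathbb{C}$ have image in $\mathbb{R}$. For integers $m, n$ satisfying $n \le -m-3$, define $$I_{m,n}^{3,tr} := \{\alpha \in (0,1) \mid \alpha^3+m\alpha^2+n\alpha+d=0 \text{ for some } d \in \mathbb{Z},\ 1 \le d \le -m-n-2\}.$$ For $m \in \{0,-1,-2,-3\}$, define $$S_m^{3,tr} := \bigcup_{n \le -m-3} I_{m,n}^{3,tr}.$$ *)

theory Defs
  imports Complex_Main "HOL-Algebra.Generated_Fields" "HOL-Algebra.Algebraic_Closure_Type"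
begin

abbreviation real_field :: "real ring" where
  "real_field \<equiv> ring_of_type_algebra"

abbreviation complex_field :: "complex ring" where
  "complex_field \<equiv> ring_of_type_algebra"

(* A unital ring homomorphism out of a field is injective, so ring_hom gives exactly the
   embeddings of K into the complex numbers; their values outside K are unconstrained,
   hence only the image of K matters. *)
definition totally_real_cubic_field :: "real set \<Rightarrow> bool" where
  "totally_real_cubic_field K \<longleftrightarrow>
     subfield K real_field \<and>
     ring.dimension real_field 3 \<rat> K \<and>
     (\<forall>\<sigma> \<in> ring_hom (real_field \<lparr>carrier := K\<rparr>) complex_field. \<sigma> ` K \<subseteq> \<real>)"

definition primitive_element :: "real \<Rightarrow> real set \<Rightarrow> bool" where
  "primitive_element \<alpha> K \<longleftrightarrow> K = generate_field real_field (insert \<alpha> \<rat>)"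

definition I3tr :: "int \<Rightarrow> int \<Rightarrow> real set" where
  "I3tr m n = {\<alpha>. 0 < \<alpha> \<and> \<alpha> < 1 \<and>
     (\<exists>d::int. 1 \<le> d \<and> d \<le> - m - n - 2 \<and>
        \<alpha> ^ 3 + of_int m * \<alpha> ^ 2 + of_int n * \<alpha> + of_int d = 0)}"

definition S3tr :: "int \<Rightarrow> real set" where
  "S3tr m = (\<Union>n \<in> {n. n \<le> - m - 3}. I3tr m n)"

end

theory Submission
  imports Defs "HOL-Analysis.Kronecker_Approximation_Theorem"
begin

text \<open>Let \<open>\<theta> \<in> K\<close> be an irrational algebraic integer of trace zero. The trace-zero integers
  \<open>k (3 \<theta>\<^sup>2 + 2 p) - h \<theta>\<close> form a lattice of rank two, so Dirichlet's approximation theorem yields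
  such a \<open>\<beta> \<notin> \<rat>\<close> with \<open>\<bar>\<beta>\<bar> < 1/2\<close>. It is a root of some \<open>X\<^sup>3 + n X + d\<close>, and \<open>n < 0\<close> because all
  conjugates of \<open>\<beta>\<close> are real. Then \<open>\<alpha> = 2 \<bar>\<beta>\<bar> \<in> (0,1)\<close> is a root of \<open>X\<^sup>3 + 4 n X \<plusminus> 8 d\<close>, and a linear
  coefficient of at most \<open>-4\<close> forces this polynomial to be positive at \<open>0\<close> and negative at \<open>1\<close>,
  which are the bounds defining \<open>S\<^sub>0\<close>. The substitution \<open>\<alpha> \<mapsto> 1 - \<alpha>\<close> leads to \<open>S\<^sub>-\<^sub>3\<close>.\<close>

section \<open>Polynomial identities\<close>

text \<open>Division of the product by \<open>x ^ 3 + n * x + d\<close> with remainder. The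
  coefficients depend on neither \<open>x\<close> nor the ring, so one formula serves a real root
  and a complex root of the same cubic.\<close>

lemma mult_quadratics_mod_cubic:
  fixes x :: "'a::comm_ring_1"
  assumes "x ^ 3 + n * x + d = 0"
  shows "(a * x\<^sup>2 + b * x + c) * (a' * x\<^sup>2 + b' * x + c')
    = (a * c' + b * b' + c * a' - n * a * a') * x\<^sup>2
      + (b * c' + c * b' - n * (a * b' + b * a') - d * a * a') * x + (c * c' - d * (a * b' + b * a'))"
    (is "?l = ?r")
proof -
  have "?l = ?r + (a * a' * x + (a * b' + b * a')) * (x ^ 3 + n * x + d)"
    by (simp add: power2_eq_square power3_eq_cube algebra_simps)
  then show ?thesis using assms by simp
qed

text \<open>The characteristic polynomial of multiplication by \<open>k (3 x\<^sup>2 + 2 p) - h x\<close>. Here \<open>3 x\<^sup>2 + 2 p\<close>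
  has trace zero because the squares of the roots of \<open>X\<^sup>3 + p X + q\<close> sum to \<open>- 2 p\<close>.\<close>

lemma trace_zero_characteristic_polynomial:
  fixes x p q h k :: "'a::comm_ring_1"
  assumes "x ^ 3 + p * x + q = 0"
  defines "y \<equiv> k * (3 * x\<^sup>2 + 2 * p) - h * x"
  shows "y ^ 3 + (p * h\<^sup>2 - 9 * q * h * k - 3 * p\<^sup>2 * k\<^sup>2) * y
    + (9 * p * q * h * k\<^sup>2 - (2 * p ^ 3 + 27 * q\<^sup>2) * k ^ 3 - 2 * p\<^sup>2 * h\<^sup>2 * k - q * h ^ 3) = 0"
proof -
  have q: "q = - (x ^ 3) - p * x"
    using assms(1) by (simp add: algebra_simps eq_neg_iff_add_eq_0)
  show ?thesis
    unfolding y_def q by (simp add: power2_eq_square power3_eq_cube algebra_simps)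
qed

section \<open>Cubic fields of real numbers\<close>

interpretation real_field: cring real_field
  by (rule cring_from_type_algebra)

lemma field_real_field: "Ring.field real_field"
  by (rule field_from_type_algebra)

lemma ring_of_type_algebra_simps [simp]:
  "carrier ring_of_type_algebra = UNIV"
  "x \<otimes>\<^bsub>ring_of_type_algebra\<^esub> y = x * y"
  "x \<oplus>\<^bsub>ring_of_type_algebra\<^esub> y = x + y"
  "\<one>\<^bsub>ring_of_type_algebra\<^esub> = 1"
  "\<zero>\<^bsub>ring_of_type_algebra\<^esub> = 0"
  by (simp_all add: ring_of_type_algebra_def)

lemma real_field_a_inv [simp]: "\<ominus>\<^bsub>real_field\<^esub> x = - x"
proof -
  have "\<ominus>\<^bsub>real_field\<^esub> x \<oplus>\<^bsub>real_field\<^esub> x = 0"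
    using real_field.l_neg[of x] by simp
  then show ?thesis by (simp add: eq_neg_iff_add_eq_0)
qed

lemma real_field_m_inv: "x \<noteq> 0 \<Longrightarrow> inv\<^bsub>real_field\<^esub> x = inverse x"
  using real_field.comm_inv_char[of x "inverse x"] by simp

lemma subfield_Rats: "subfield \<rat> real_field"
proof (rule field.subfieldI'[OF field_real_field])
  show "subring \<rat> real_field"
    by (rule real_field.subringI) auto
qed (auto simp: real_field_m_inv)

lemma mem_Span_pair_one:
  "x \<in> real_field.Span \<rat> [u, 1] \<longleftrightarrow> (\<exists>a\<in>\<rat>. \<exists>b\<in>\<rat>. x = a * u + b)"
  by (fastforce simp: real_field.line_extension_mem_iff)

lemma mem_Span_triple_one:
  "x \<in> real_field.Span \<rat> [u, v, 1] \<longleftrightarrow> (\<exists>a\<in>\<rat>. \<exists>b\<in>\<rat>. \<exists>c\<in>\<rat>. x = a * u + b * v + c)"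
  by (simp add: real_field.line_extension_mem_iff Bex_def add.assoc) blast

abbreviation Rats_quad :: "real \<Rightarrow> real set" where
  "Rats_quad \<theta> \<equiv> {a * \<theta>\<^sup>2 + b * \<theta> + c | a b c. a \<in> \<rat> \<and> b \<in> \<rat> \<and> c \<in> \<rat>}"

locale real_cubic_field =
  fixes K :: "real set"
  assumes subfield: "subfield K real_field"
    and dimension: "real_field.dimension 3 \<rat> K"
begin

lemma add_closed: "x \<in> K \<Longrightarrow> y \<in> K \<Longrightarrow> x + y \<in> K"
  and mult_closed: "x \<in> K \<Longrightarrow> y \<in> K \<Longrightarrow> x * y \<in> K"
  and one_closed: "1 \<in> K"
  using subringE[OF subfieldE(1)[OF subfield]] by auto

lemma Rats_subset: "\<rat> \<subseteq> K"
  using real_field.space_subgroup_props(5)[OF subfield_Rats dimension _ one_closed] by auto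

section \<open>Rational bases formed by the powers of an irrational element\<close>

lemma spans_if_independent:
  assumes "real_field.independent \<rat> Us" "set Us \<subseteq> K" "length Us = 3"
  shows "real_field.Span \<rat> Us = K"
  using real_field.independent_length_eq_dimension[OF subfield_Rats dimension assms(1,2)] assms(3)
  by simp

text \<open>A quadratic \<theta> would generate a field of degree 2 inside one of degree 3.
  Concretely, for \<open>w\<close> outside the span of \<theta> and 1, expanding
  \<theta>\<open>* w\<close> in the basis \<open>w\<close>, \<theta>, 1 puts
  (\<theta>\<open>- a) * w\<close> into that span; dividing by \<theta>\<open>- a\<close> puts
  \<open>w\<close> there too.\<close>

lemma irrational_square_neq_linear:
  assumes \<theta>: "\<theta> \<in> K" "\<theta> \<notin> \<rat>" and rat: "x \<in> \<rat>" "y \<in> \<rat>"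
  shows "\<theta>\<^sup>2 \<noteq> x * \<theta> + y"
proof
  assume eq: "\<theta>\<^sup>2 = x * \<theta> + y"
  have ind2: "real_field.independent \<rat> [\<theta>, 1]"
    using \<theta> by (auto intro!: real_field.li_Cons simp: real_field.line_extension_mem_iff)
  moreover have "set [\<theta>, 1] \<subseteq> K"
    using \<theta> one_closed by auto
  ultimately have "real_field.Span \<rat> [\<theta>, 1] \<noteq> K" "real_field.Span \<rat> [\<theta>, 1] \<subseteq> K"
    using real_field.independent_length_eq_dimension[OF subfield_Rats dimension, of "[\<theta>, 1]"]
      \<theta> one_closed Rats_subset
    by (auto simp del: real_field.Span.simps simp: mem_Span_pair_one intro!: add_closed mult_closed)
  then obtain w where w: "w \<in> K" "w \<notin> real_field.Span \<rat> [\<theta>, 1]" by blast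
  then have "real_field.independent \<rat> [w, \<theta>, 1]"
    by (intro real_field.li_Cons[OF _ _ ind2]) auto
  then have "real_field.Span \<rat> [w, \<theta>, 1] = K"
    using \<theta> one_closed w by (intro spans_if_independent) auto
  moreover have "\<theta> * w \<in> K" using \<theta> w by (intro mult_closed)
  ultimately obtain a b c where abc: "a \<in> \<rat>" "b \<in> \<rat>" "c \<in> \<rat>" "\<theta> * w = a * w + (b * \<theta> + c)"
    by (auto simp: real_field.line_extension_mem_iff)
  \<comment> \<open>Up to sign, \<open>r\<close> is the norm of \<theta>\<open>- a\<close>, as the
    conjugate of \<theta> is \<open>x -\<close>\<theta>. Division by \<theta>\<open>- a\<close> thus
    becomes division by a rational number.\<close>
  define r where "r = y + x * a - a\<^sup>2"
  have r: "(\<theta> - a) * (\<theta> - x + a) = r"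
    using eq unfolding r_def by (simp add: power2_eq_square algebra_simps)
  have "\<theta> \<noteq> a" "\<theta> \<noteq> x - a"
    using \<theta> abc(1) Rats_diff[OF rat(1) abc(1)] by auto
  then have "\<theta> - a \<noteq> 0" "\<theta> - x + a \<noteq> 0" by auto
  then have "r \<noteq> 0" using r by auto
  have "(\<theta> - a) * w = b * \<theta> + c" using abc(4) by (simp add: algebra_simps)
  then have "r * w = (\<theta> - x + a) * (b * \<theta> + c)"
    unfolding r[symmetric] by (metis mult.assoc mult.commute)
  also have "\<dots> = b * \<theta>\<^sup>2 + (c - b * x + b * a) * \<theta> + c * (a - x)"
    by (simp add: power2_eq_square algebra_simps)
  also have "\<dots> = (b * a + c) * \<theta> + (b * y + c * (a - x))"
    unfolding eq by (simp add: algebra_simps)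
  finally have "w = (b * a + c) / r * \<theta> + (b * y + c * (a - x)) / r"
    using \<open>r \<noteq> 0\<close> by (simp add: field_simps)
  moreover have "r \<in> \<rat>" unfolding r_def using abc rat by auto
  then have "(b * a + c) / r \<in> \<rat>" "(b * y + c * (a - x)) / r \<in> \<rat>"
    using abc(1-3) rat by auto
  ultimately have "w \<in> real_field.Span \<rat> [\<theta>, 1]"
    unfolding mem_Span_pair_one by blast
  with w show False by simp
qed

lemma quad_eq_zero_iff:
  assumes \<theta>: "\<theta> \<in> K" "\<theta> \<notin> \<rat>" and rat: "a \<in> \<rat>" "b \<in> \<rat>" "c \<in> \<rat>"
  shows "a * \<theta>\<^sup>2 + b * \<theta> + c = 0 \<longleftrightarrow> a = 0 \<and> b = 0 \<and> c = 0"
proof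
  assume eq: "a * \<theta>\<^sup>2 + b * \<theta> + c = 0"
  have "a = 0"
  proof (rule ccontr)
    assume "a \<noteq> 0"
    then have "\<theta>\<^sup>2 = (- b / a) * \<theta> + (- c / a)" using eq by (simp add: field_simps)
    with irrational_square_neq_linear[OF \<theta>, of "- b / a" "- c / a"] rat show False by auto
  qed
  moreover have "b = 0"
  proof (rule ccontr)
    assume "b \<noteq> 0"
    then have "\<theta> = - c / b" using eq \<open>a = 0\<close> by (simp add: field_simps)
    with \<theta> rat show False by auto
  qed
  ultimately show "a = 0 \<and> b = 0 \<and> c = 0" using eq by simp
qed simp

lemma quad_eq_iff:
  assumes \<theta>: "\<theta> \<in> K" "\<theta> \<notin> \<rat>"
    and rat: "a \<in> \<rat>" "b \<in> \<rat>" "c \<in> \<rat>" "a' \<in> \<rat>" "b' \<in> \<rat>" "c' \<in> \<rat>"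
  shows "a * \<theta>\<^sup>2 + b * \<theta> + c = a' * \<theta>\<^sup>2 + b' * \<theta> + c' \<longleftrightarrow> a = a' \<and> b = b' \<and> c = c'"
  using quad_eq_zero_iff[OF \<theta>, of "a - a'" "b - b'" "c - c'"] rat by (auto simp: algebra_simps)

lemma eq_Rats_quad:
  assumes \<theta>: "\<theta> \<in> K" "\<theta> \<notin> \<rat>"
  shows "K = Rats_quad \<theta>"
proof -
  have "real_field.independent \<rat> [\<theta>\<^sup>2, \<theta>, 1]"
    using \<theta> irrational_square_neq_linear[OF \<theta>]
    by (auto intro!: real_field.li_Cons simp: real_field.line_extension_mem_iff)
  then have "K = real_field.Span \<rat> [\<theta>\<^sup>2, \<theta>, 1]"
    using spans_if_independent[of "[\<theta>\<^sup>2, \<theta>, 1]"] \<theta> one_closed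
    by (auto simp: power2_eq_square intro!: mult_closed)
  also have "\<dots> = Rats_quad \<theta>"
    unfolding set_eq_iff mem_Span_triple_one by blast
  finally show ?thesis .
qed

text \<open>A field that contains the rationals and \<theta> contains every rational quadratic
  expression in \<theta>, and these already fill \<open>K\<close>.\<close>

lemma primitive_element_if_irrational:
  assumes \<theta>: "\<theta> \<in> K" "\<theta> \<notin> \<rat>"
  shows "primitive_element \<theta> K"
  unfolding primitive_element_def
proof (rule field.generate_fieldI[OF field_real_field])
  show "insert \<theta> \<rat> \<subseteq> carrier real_field" by simp
  show "subfield K real_field" by (rule subfield)
  show "insert \<theta> \<rat> \<subseteq> K" using \<theta> Rats_subset by simp
  fix L assume L: "subfield L real_field" "insert \<theta> \<rat> \<subseteq> L"
  have "Rats_quad \<theta> \<subseteq> L"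
    using subringE(6,7)[OF subfieldE(1)[OF L(1)]] L(2)
    by (auto simp: power2_eq_square subset_iff)
  then show "K \<subseteq> L" using eq_Rats_quad[OF \<theta>] by simp
qed

section \<open>Integral elements of trace zero\<close>

lemma exists_irrational: "\<exists>\<theta>\<in>K. \<theta> \<notin> \<rat>"
proof (rule ccontr)
  assume "\<not> ?thesis"
  then have "K = \<rat>" using Rats_subset by auto
  then have "real_field.dimension 3 \<rat> \<rat>" using dimension by simp
  from real_field.dimension_is_inj[OF subfield_Rats this real_field.dimension_one[OF subfield_Rats]]
  show False by simp
qed

text \<open>Scaling by a common denominator makes the cubic relation of an irrational element
  integral; a shift then removes its quadratic term.\<close>

lemma exists_integral_trace_zero:
  "\<exists>\<theta>\<in>K. \<theta> \<notin> \<rat> \<and> (\<exists>p q. \<theta> ^ 3 + of_int p * \<theta> + of_int q = 0)"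
proof -
  obtain \<theta> where \<theta>: "\<theta> \<in> K" "\<theta> \<notin> \<rat>" using exists_irrational by blast
  have "\<theta> ^ 3 \<in> K" using \<theta> by (auto simp: power3_eq_cube intro!: mult_closed)
  then obtain a b c where abc: "a \<in> \<rat>" "b \<in> \<rat>" "c \<in> \<rat>" "\<theta> ^ 3 = a * \<theta>\<^sup>2 + b * \<theta> + c"
    using eq_Rats_quad[OF \<theta>] by blast
  obtain a1 a2 :: int where a: "a2 \<noteq> 0" "a = a1 / a2"
    using abc(1) by (metis Rats_cases' of_int_0_less_iff less_irrefl)
  obtain b1 b2 :: int where b: "b2 \<noteq> 0" "b = b1 / b2"
    using abc(2) by (metis Rats_cases' of_int_0_less_iff less_irrefl)
  obtain c1 c2 :: int where c: "c2 \<noteq> 0" "c = c1 / c2"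
    using abc(3) by (metis Rats_cases' of_int_0_less_iff less_irrefl)
  \<comment> \<open>For \<open>t = M *\<close>\<theta> the coefficients \<open>a\<close>,
    \<open>b\<close>, \<open>c\<close> get multiplied by \<open>M\<close>, \<open>M\<^sup>2\<close>,
    \<open>M ^ 3\<close>, which clears all three denominators.\<close>
  define M where "M = a2 * b2 * c2"
  define A where "A = a1 * b2 * c2"
  define B where "B = b1 * a2 * c2 * M"
  define C where "C = c1 * a2 * b2 * M\<^sup>2"
  have ABC: "M * a = A" "M\<^sup>2 * b = B" "M ^ 3 * c = C"
    using a b c by (simp_all add: M_def A_def B_def C_def field_simps power2_eq_square power3_eq_cube)
  define t where "t = M * \<theta>"
  have "t ^ 3 = M ^ 3 * \<theta> ^ 3" by (simp add: t_def power_mult_distrib)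
  also have "\<dots> = (M * a) * t\<^sup>2 + (M\<^sup>2 * b) * t + M ^ 3 * c"
    unfolding abc(4) t_def by (simp add: power2_eq_square power3_eq_cube algebra_simps)
  finally have t: "t ^ 3 = A * t\<^sup>2 + B * t + C" unfolding ABC by simp
  \<comment> \<open>\<open>A\<close> is the sum of the roots of the cubic of \<open>t\<close>, so
    \<open>t - A / 3\<close> has trace zero; the factor 3 keeps the coefficients integral.\<close>
  define u where "u = 3 * t - A"
  have "u ^ 3 + of_int (- 3 * A\<^sup>2 - 9 * B) * u + of_int (- 2 * A ^ 3 - 9 * A * B - 27 * C)
      = 27 * (t ^ 3 - A * t\<^sup>2 - B * t - C)"
    unfolding u_def by (simp add: power2_eq_square power3_eq_cube algebra_simps)
  also have "\<dots> = 0" using t by simp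
  finally have "u ^ 3 + of_int (- 3 * A\<^sup>2 - 9 * B) * u + of_int (- 2 * A ^ 3 - 9 * A * B - 27 * C) = 0" .
  moreover have u: "u = 0 * \<theta>\<^sup>2 + (3 * M) * \<theta> + (- A)" by (simp add: u_def t_def)
  have "u \<in> Rats_quad \<theta>" by (rule CollectI, intro exI conjI, rule u) auto
  then have "u \<in> K" using eq_Rats_quad[OF \<theta>] by simp
  moreover have "u \<notin> \<rat>"
  proof
    assume "u \<in> \<rat>"
    moreover have "0 * \<theta>\<^sup>2 + (3 * M) * \<theta> + (- A - u) = 0" using u by simp
    ultimately have "3 * real_of_int M = 0"
      using quad_eq_zero_iff[OF \<theta>, of 0 "3 * M" "- A - u"] by simp
    then show False using a b c by (simp add: M_def)
  qed
  ultimately show ?thesis by blast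
qed

lemma exists_small_integral_trace_zero:
  "\<exists>\<beta>\<in>K. \<beta> \<notin> \<rat> \<and> \<bar>\<beta>\<bar> < 1 / 2 \<and> (\<exists>n d. \<beta> ^ 3 + of_int n * \<beta> + of_int d = 0)"
proof -
  obtain \<theta> :: real and p q :: int where \<theta>: "\<theta> \<in> K" "\<theta> \<notin> \<rat>" and root: "\<theta> ^ 3 + p * \<theta> + q = 0"
    using exists_integral_trace_zero by blast
  have "\<theta> \<noteq> 0" using \<theta> by auto
  define \<gamma> where "\<gamma> = 3 * \<theta>\<^sup>2 + 2 * p"
  \<comment> \<open>This bound on the denominator makes \<bar>\<theta>\<bar>\<open>/ M\<close> at
    most 1/2, while \<beta> is \<theta> times the approximation error of
    \<gamma>\<open>/\<close>\<theta>.\<close>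
  define M where "M = nat \<lceil>2 * \<bar>\<theta>\<bar>\<rceil>"
  have M: "M > 0" "2 * \<bar>\<theta>\<bar> \<le> M" using \<open>\<theta> \<noteq> 0\<close> by (auto simp: M_def)
  obtain h k :: int where hk: "0 < k" "\<bar>k * (\<gamma> / \<theta>) - h\<bar> < 1 / M"
    using Dirichlet_approx[OF M(1)] by metis
  define \<beta> where "\<beta> = k * \<gamma> - h * \<theta>"
  have "\<bar>\<beta>\<bar> = \<bar>\<theta>\<bar> * \<bar>k * (\<gamma> / \<theta>) - h\<bar>"
    using \<open>\<theta> \<noteq> 0\<close> by (simp add: \<beta>_def abs_mult[symmetric] algebra_simps)
  also have "\<dots> < \<bar>\<theta>\<bar> * (1 / M)"
    using \<open>\<theta> \<noteq> 0\<close> hk(2) by (intro mult_strict_left_mono) auto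
  also have "\<dots> \<le> 1 / 2" using M by (simp add: field_simps)
  finally have small: "\<bar>\<beta>\<bar> < 1 / 2" .
  have \<beta>: "\<beta> = (3 * k) * \<theta>\<^sup>2 + (- h) * \<theta> + (2 * p * k)"
    by (simp add: \<beta>_def \<gamma>_def algebra_simps)
  have "\<beta> \<in> Rats_quad \<theta>" by (rule CollectI, intro exI conjI, rule \<beta>) auto
  then have "\<beta> \<in> K" using eq_Rats_quad[OF \<theta>] by simp
  \<comment> \<open>Dirichlet's theorem gives \<open>k > 0\<close>, so the coefficient
    \<open>3 * k\<close> of \<theta> squared cannot vanish.\<close>
  moreover have "\<beta> \<notin> \<rat>"
  proof
    assume "\<beta> \<in> \<rat>"
    moreover have "(3 * k) * \<theta>\<^sup>2 + (- h) * \<theta> + (2 * p * k - \<beta>) = 0" using \<beta> by simp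
    ultimately have "3 * real_of_int k = 0"
      using quad_eq_zero_iff[OF \<theta>, of "3 * k" "- h" "2 * p * k - \<beta>"] by simp
    then show False using hk(1) by simp
  qed
  moreover have "\<exists>n d. \<beta> ^ 3 + of_int n * \<beta> + of_int d = 0"
  proof (intro exI)
    show "\<beta> ^ 3 + of_int (p * h\<^sup>2 - 9 * q * h * k - 3 * p\<^sup>2 * k\<^sup>2) * \<beta>
      + of_int (9 * p * q * h * k\<^sup>2 - (2 * p ^ 3 + 27 * q\<^sup>2) * k ^ 3 - 2 * p\<^sup>2 * h\<^sup>2 * k - q * h ^ 3) = 0"
      unfolding \<beta>_def \<gamma>_def of_int_add of_int_diff of_int_mult of_int_power of_int_numeral
      by (rule trace_zero_characteristic_polynomial[OF root])
  qed
  ultimately show ?thesis using small by blast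
qed

text \<open>If \<open>n \<ge> 0\<close>, then \<open>X\<^sup>3 + n X + d\<close> is increasing, so its other roots are not real, and mapping
  \<open>\<beta>\<close> to such a root defines an embedding that is not real.\<close>

lemma linear_coeff_neg_if_totally_real:
  assumes real: "\<forall>\<sigma> \<in> ring_hom (real_field\<lparr>carrier := K\<rparr>) complex_field. \<sigma> ` K \<subseteq> \<real>"
    and \<beta>: "\<beta> \<in> K" "\<beta> \<notin> \<rat>" and root: "\<beta> ^ 3 + of_int n * \<beta> + of_int d = 0"
  shows "n < 0"
proof (rule ccontr)
  assume "\<not> n < 0"
  then have n: "0 \<le> n" by simp
  have "\<beta> \<noteq> 0" using \<beta> by auto
  \<comment> \<open>Dividing the cubic by \<open>X -\<close>\<beta> leaves
    \<open>X\<^sup>2 +\<close>\<beta>\<open>* X +\<close>\<beta>\<open>\<^sup>2 + n\<close>, whose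
    discriminant is \<open>- s\<^sup>2\<close>; \<open>z\<close> below is its root with positive
    imaginary part.\<close>
  define s where "s = sqrt (3 * \<beta>\<^sup>2 + 4 * n)"
  have "3 * \<beta>\<^sup>2 + 4 * n > 0" using n \<open>\<beta> \<noteq> 0\<close> by (intro add_pos_nonneg) auto
  then have s: "s > 0" "s\<^sup>2 = 3 * \<beta>\<^sup>2 + 4 * n" by (simp_all add: s_def)
  define z where "z = Complex (- \<beta> / 2) (s / 2)"
  have "z\<^sup>2 = Complex ((\<beta>\<^sup>2 - s\<^sup>2) / 4) (- \<beta> * s / 2)"
    by (simp add: z_def complex_eq_iff power2_eq_square field_simps)
  moreover have "complex_of_real (\<beta>\<^sup>2) = Complex (\<beta>\<^sup>2) 0" by (simp add: complex_eq_iff)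
  ultimately have "z\<^sup>2 + \<beta> * z + \<beta>\<^sup>2 + n = 0"
    unfolding s(2) by (simp add: z_def complex_eq_iff power2_eq_square)
  moreover have d: "(of_int d :: complex) = - (\<beta> ^ 3) - n * \<beta>"
  proof -
    have "complex_of_real (of_int d) = of_real (- (\<beta> ^ 3) - n * \<beta>)"
      using root by (intro arg_cong[of _ _ complex_of_real]) simp
    then show ?thesis by simp
  qed
  moreover have "z ^ 3 + n * z + d = (z - \<beta>) * (z\<^sup>2 + \<beta> * z + \<beta>\<^sup>2 + n)"
    unfolding d by (simp add: power2_eq_square power3_eq_cube algebra_simps)
  ultimately have z: "z ^ 3 + of_int n * z + of_int d = 0" by simp
  let ?\<beta> = "\<lambda>a b c. a * \<beta>\<^sup>2 + b * \<beta> + c"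
  let ?z = "\<lambda>a b c. complex_of_real a * z\<^sup>2 + complex_of_real b * z + complex_of_real c"
  \<comment> \<open>The coordinates of an element of \<open>K\<close> with respect to \<beta>
    squared, \<beta>, 1 are unique, so the description determines one value there.\<close>
  define \<sigma> where "\<sigma> x = (THE w. \<exists>a\<in>\<rat>. \<exists>b\<in>\<rat>. \<exists>c\<in>\<rat>. x = ?\<beta> a b c \<and> w = ?z a b c)" for x
  have \<sigma>: "\<sigma> (?\<beta> a b c) = ?z a b c" if "a \<in> \<rat>" "b \<in> \<rat>" "c \<in> \<rat>" for a b c
    unfolding \<sigma>_def using that quad_eq_iff[OF \<beta>] by (intro the_equality) auto
  have "\<sigma> \<in> ring_hom (real_field\<lparr>carrier := K\<rparr>) complex_field"
  proof (rule ring_hom_memI, goal_cases)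
    case (2 x y)
    then obtain a b c a' b' c' where rat: "a \<in> \<rat>" "b \<in> \<rat>" "c \<in> \<rat>" "a' \<in> \<rat>" "b' \<in> \<rat>" "c' \<in> \<rat>"
      and xy: "x = ?\<beta> a b c" "y = ?\<beta> a' b' c'"
      using eq_Rats_quad[OF \<beta>] by auto
    \<comment> \<open>Reduction modulo the common cubic of \<beta> and \<open>z\<close> gives the
      same coordinates on both sides, whence \<sigma> is multiplicative.\<close>
    have "x * y = ?\<beta> (a * c' + b * b' + c * a' - n * a * a')
       (b * c' + c * b' - n * (a * b' + b * a') - d * a * a') (c * c' - d * (a * b' + b * a'))"
      unfolding xy by (rule mult_quadratics_mod_cubic[OF root])
    then have "\<sigma> (x * y) = ?z (a * c' + b * b' + c * a' - n * a * a')
       (b * c' + c * b' - n * (a * b' + b * a') - d * a * a') (c * c' - d * (a * b' + b * a'))"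
      using rat by (simp only:) (rule \<sigma>; auto)
    also have "\<dots> = ?z a b c * ?z a' b' c'"
      unfolding of_real_add of_real_diff of_real_mult of_real_of_int_eq
      by (rule mult_quadratics_mod_cubic[OF z, symmetric])
    finally show ?case using rat by (simp add: xy \<sigma>)
  next
    case (3 x y)
    then obtain a b c a' b' c' where rat: "a \<in> \<rat>" "b \<in> \<rat>" "c \<in> \<rat>" "a' \<in> \<rat>" "b' \<in> \<rat>" "c' \<in> \<rat>"
      and xy: "x = ?\<beta> a b c" "y = ?\<beta> a' b' c'"
      using eq_Rats_quad[OF \<beta>] by auto
    have "x + y = ?\<beta> (a + a') (b + b') (c + c')" unfolding xy by (simp add: algebra_simps)
    then have "\<sigma> (x + y) = ?z (a + a') (b + b') (c + c')"
      using rat by (simp only:) (rule \<sigma>; auto)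
    also have "\<dots> = ?z a b c + ?z a' b' c'" by (simp add: algebra_simps)
    finally show ?case using rat by (simp add: xy \<sigma>)
  next
    case 4
    show ?case using \<sigma>[of 0 0 1] by simp
  qed simp
  then have "\<sigma> \<beta> \<in> \<real>" using real \<beta> by blast
  then have "z \<in> \<real>" using \<sigma>[of 0 1 0] by simp
  then show False using s by (simp add: z_def complex_is_Real_iff)
qed

end

section \<open>Roots in the unit interval\<close>

text \<open>The numbers \<open>d\<close> and \<open>1 + n + d\<close> are the values of the cubic at
  0 and 1. The vanishing at \<alpha> lets one split off the factors \<alpha> and
  \<open>1 -\<close>\<alpha>; the cofactors have a definite sign because 1 + \<alpha> +
  \<open>\<alpha>\<^sup>2\<close> is below 3.\<close>

lemma trinomial_coeff_bounds:
  fixes \<alpha> :: real and n d :: int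
  assumes \<alpha>: "0 < \<alpha>" "\<alpha> < 1" and root: "\<alpha> ^ 3 + n * \<alpha> + d = 0" and n: "n \<le> - 4"
  shows "1 \<le> d" "d \<le> - n - 2"
proof -
  have n': "real_of_int n \<le> - 4" using n by linarith
  have \<alpha>2: "\<alpha>\<^sup>2 < 1" using \<alpha> by (simp add: power_less_one_iff)
  have "real_of_int d = \<alpha> * (- n - \<alpha>\<^sup>2)"
    using root by (simp add: power2_eq_square power3_eq_cube algebra_simps)
  also have "\<dots> > 0" using \<alpha> \<alpha>2 n' by (intro mult_pos_pos) auto
  finally show "1 \<le> d" by simp
  have "real_of_int (1 + n + d) = (1 - \<alpha>) * (1 + \<alpha> + \<alpha>\<^sup>2 + n)"
    using root by (simp add: power2_eq_square power3_eq_cube algebra_simps)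
  also have "\<dots> < 0" using \<alpha> \<alpha>2 n' by (intro mult_pos_neg) auto
  finally have "1 + n + d < 0" by simp
  then show "d \<le> - n - 2" by simp
qed

lemma mem_S3tr_0:
  fixes \<alpha> :: real and n d :: int
  assumes "0 < \<alpha>" "\<alpha> < 1" "\<alpha> ^ 3 + n * \<alpha> + d = 0" "n \<le> - 4"
  shows "\<alpha> \<in> S3tr 0"
proof -
  have "\<alpha> \<in> I3tr 0 n"
    using assms trinomial_coeff_bounds[OF assms] unfolding I3tr_def by auto
  moreover have "n \<le> - 0 - 3" using assms(4) by simp
  ultimately show ?thesis unfolding S3tr_def by blast
qed

text \<open>Substituting \<open>1 - X\<close> and changing the sign turns
  \<open>X\<^sup>3 + n X + d\<close> into a monic cubic with quadratic coefficient -3 and constant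
  term \<open>- 1 - n - d\<close>. The two bounds on \<open>d\<close> thereby exchange
  roles.\<close>

lemma one_minus_mem_S3tr_minus_3:
  fixes \<alpha> :: real and n d :: int
  assumes "0 < \<alpha>" "\<alpha> < 1" "\<alpha> ^ 3 + n * \<alpha> + d = 0" "n \<le> - 4"
  shows "1 - \<alpha> \<in> S3tr (- 3)"
proof -
  have "(1 - \<alpha>) ^ 3 + of_int (- 3) * (1 - \<alpha>)\<^sup>2 + of_int (n + 3) * (1 - \<alpha>) + of_int (- 1 - n - d) = 0"
    using assms(3) by (simp add: power2_eq_square power3_eq_cube algebra_simps)
  then have "1 - \<alpha> \<in> I3tr (- 3) (n + 3)"
    using assms(1,2,4) trinomial_coeff_bounds[OF assms] unfolding I3tr_def
    by (intro CollectI conjI exI[of _ "- 1 - n - d"]) auto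
  moreover have "n + 3 \<le> - (- 3) - 3" using assms(4) by simp
  ultimately show ?thesis unfolding S3tr_def by blast
qed

lemma exists_root_in_unit_interval:
  assumes "totally_real_cubic_field K"
  shows "\<exists>\<alpha>\<in>K. \<alpha> \<notin> \<rat> \<and> 0 < \<alpha> \<and> \<alpha> < 1 \<and> (\<exists>n d. n \<le> - 4 \<and> \<alpha> ^ 3 + of_int n * \<alpha> + of_int d = 0)"
proof -
  interpret real_cubic_field K
    using assms by (simp add: totally_real_cubic_field_def real_cubic_field_def)
  obtain \<beta> :: real and n d :: int where \<beta>: "\<beta> \<in> K" "\<beta> \<notin> \<rat>" "\<bar>\<beta>\<bar> < 1 / 2" "\<beta> ^ 3 + n * \<beta> + d = 0"
    using exists_small_integral_trace_zero by blast
  have "n < 0"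
    using linear_coeff_neg_if_totally_real[OF _ \<beta>(1,2,4)] assms
    by (simp add: totally_real_cubic_field_def)
  \<comment> \<open>The sign makes the root positive. The factor 2 keeps it below 1 and multiplies
    the negative integer \<open>n\<close> by 4, which yields the bound -4.\<close>
  define e :: int where "e = (if \<beta> < 0 then - 2 else 2)"
  have e: "e * \<beta> = 2 * \<bar>\<beta>\<bar>" "e\<^sup>2 = 4" by (auto simp: e_def)
  have "(e * \<beta>) ^ 3 + of_int (4 * n) * (e * \<beta>) + of_int (e ^ 3 * d) = e ^ 3 * (\<beta> ^ 3 + n * \<beta> + d)"
    unfolding e(2)[symmetric] by (simp add: power2_eq_square power3_eq_cube algebra_simps)
  then have "(e * \<beta>) ^ 3 + of_int (4 * n) * (e * \<beta>) + of_int (e ^ 3 * d) = 0"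
    using \<beta>(4) by simp
  moreover have "4 * n \<le> - 4" using \<open>n < 0\<close> by simp
  moreover have "0 < e * \<beta>" "e * \<beta> < 1" unfolding e(1) using \<beta> by auto
  moreover have "e * \<beta> \<in> K" using \<beta>(1) Rats_subset by (auto intro!: mult_closed)
  moreover have "e * \<beta> \<notin> \<rat>"
  proof
    assume "e * \<beta> \<in> \<rat>"
    then have "e * \<beta> / e \<in> \<rat>" by (rule Rats_divide) simp
    then show False using \<beta>(2) by (simp add: e_def split: if_splits)
  qed
  ultimately show ?thesis by blast
qed

theorem theorem16:
  shows "(\<forall>K. totally_real_cubic_field K \<longrightarrow> (\<exists>\<alpha> \<in> S3tr 0. primitive_element \<alpha> K)) \<and>
         (\<forall>K. totally_real_cubic_field K \<longrightarrow> (\<exists>\<alpha> \<in> S3tr (- 3). primitive_element \<alpha> K))"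
proof -
  have "(\<exists>\<alpha>\<in>S3tr 0. primitive_element \<alpha> K) \<and> (\<exists>\<alpha>\<in>S3tr (- 3). primitive_element \<alpha> K)"
    if K: "totally_real_cubic_field K" for K
  proof -
    interpret real_cubic_field K
      using K by (simp add: totally_real_cubic_field_def real_cubic_field_def)
    obtain \<alpha> :: real and n d :: int where \<alpha>: "\<alpha> \<in> K" "\<alpha> \<notin> \<rat>"
      and bounds: "0 < \<alpha>" "\<alpha> < 1" "\<alpha> ^ 3 + n * \<alpha> + d = 0" "n \<le> - 4"
      using exists_root_in_unit_interval[OF K] by blast
    have "- 1 \<in> K" using Rats_subset by (rule subsetD) simp
    then have "1 - \<alpha> \<in> K"
      using add_closed[OF one_closed mult_closed[of "- 1" \<alpha>]] \<alpha>(1) by simp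
    moreover have "1 - \<alpha> \<notin> \<rat>"
      using \<alpha>(2) Rats_diff[of 1 "1 - \<alpha>"] by auto
    ultimately show ?thesis
      using primitive_element_if_irrational \<alpha> mem_S3tr_0[OF bounds]
        one_minus_mem_S3tr_minus_3[OF bounds] by blast
  qed
  then show ?thesis by blast
qed

end
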